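(* (Non-cylindrical maximum principle.) Let $\Omega=M^n$ be compact and let $(M_t)_{t\in(0,T)}$ be a solution of the volume preserving mean curvature flow consisting of hypersurfaces $M_t=\mathbf{x}_t(\Omega)$, where $\mathbf{x}_t=\mathbf{x}(\cdot,t)$ and $\mathbf{x}:\Omega\times[0,T)\to\mathbb{R}^{n+1}$. Let $V\subset\Omega\times(0,T)$ be open (a possibly non-cylindrical domain). Suppose $f\in C^{2,1}(V)\cap C(\overline V)$ satisfies on $V$ an inequality of the form $$\Bigl(\frac{d}{dt}-\Delta\Bigr)f\le\langle a,\nabla f\rangle,$$ where the Laplacian $\Delta$ and the gradient $\nabla$ are computed on the manifold $M_t$, and where the vector field $a:V\to\mathbb{R}^{n+1}$ is only required to be continuous in a neighbourhood of all maximum points of $f$. Then $$\sup_V f\le\sup_{\Gamma_V}f .$$ If moreover $f$ has a positive supremum in $V$, then $$\sup_V f\le\sup_{\delta_V}f .$$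
   Context: $M^n$ is an $n$-dimensional manifold. Volume preserving mean curvature flow: a family of smooth immersions $\mathbf{x}(\cdot,t):M^n\to\mathbb{R}^{n+1}$ with $\frac{d}{dt}\mathbf{x}(l,t)=-(H(l,t)-h(t))\nu(l,t)$, where $\nu$ is a smooth unit normal of $M_t$, $H$ the mean curvature with respect to $\nu$ and $h(t)=\int_{M_t}H\,dg_t/\int_{M_t}dg_t$ its average over $M_t$. Notation for the domain $V$: $\Omega_t=\Omega\times\{t\}$; $\overline V$ is the closure of $V$; $\partial V=\overline V\setminus V$; the parabolic boundary is $\Gamma_V=\partial V\setminus\Omega_T$. For $0<t<T$, $Z_t$ is the largest subset of $\Omega_t\cap\partial V$ that is open in $\partial V$ and can be reached from below in $V$ (with $t$ as vertical axis), i.e. each point $(l,t)\in Z_t$ has a neighbourhood $U$ of $l$ in $\Omega$ and $\varepsilon>0$ with $U\times(t-\varepsilon,t)\subset V$. Put $Z_V=\bigcup_{0<t<T}Z_t$ and $\delta_V=\Gamma_V\setminus Z_V$. *)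

theory Defs
  imports "HOL-Analysis.Analysis"
begin

section \<open>Smooth maps on open subsets of normed spaces\<close>

text \<open>Both notions are meant for open \<open>S\<close>. On a finite-dimensional space, continuity of all
  directional derivatives up to order \<open>k\<close> is the usual class \<open>C\<^sup>k\<close>.\<close>

fun Ck_on :: "nat \<Rightarrow> 'a::real_normed_vector set \<Rightarrow> ('a \<Rightarrow> 'b::real_normed_vector) \<Rightarrow> bool" where
  "Ck_on 0 S F \<longleftrightarrow> continuous_on S F"
| "Ck_on (Suc k) S F \<longleftrightarrow> (\<forall>x\<in>S. F differentiable (at x)) \<and>
     (\<forall>v. Ck_on k S (\<lambda>x. frechet_derivative F (at x) v))"

definition smooth_on :: "'a::real_normed_vector set \<Rightarrow> ('a \<Rightarrow> 'b::real_normed_vector) \<Rightarrow> bool" where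
  "smooth_on S F \<longleftrightarrow> (\<forall>k. Ck_on k S F)"


section \<open>Smooth manifolds\<close>

text \<open>The manifold is a whole topological type \<open>'m\<close>. A chart is a pair of its domain and the
  coordinate map; the values of the map outside the domain are irrelevant.\<close>

type_synonym ('m, 'n) chart = "'m set \<times> ('m \<Rightarrow> real ^ 'n)"

definition param :: "('m, 'n) chart \<Rightarrow> real ^ 'n \<Rightarrow> 'm" where
  "param c = inv_into (fst c) (snd c)"

definition smooth_atlas :: "('m::topological_space, 'n::finite) chart set \<Rightarrow> bool" where
  "smooth_atlas A \<longleftrightarrow>
     (\<Union>c\<in>A. fst c) = UNIV \<and>
     (\<forall>c\<in>A. open (fst c) \<and> open (snd c ` fst c) \<and>
        homeomorphism (fst c) (snd c ` fst c) (snd c) (param c)) \<and>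
     (\<forall>c\<in>A. \<forall>d\<in>A. smooth_on (snd c ` (fst c \<inter> fst d)) (snd d \<circ> param c))"

text \<open>An arbitrary chart around a point, used to evaluate expressions that do not depend on the
  choice of coordinates.\<close>

definition chart_at :: "('m, 'n) chart set \<Rightarrow> 'm \<Rightarrow> ('m, 'n) chart" where
  "chart_at A l = (SOME c. c \<in> A \<and> l \<in> fst c)"

text \<open>Coordinate derivative \<open>\<partial>\<^sub>i F\<close> in the chart \<open>c\<close>, as a function on the domain of \<open>c\<close>.\<close>

definition pd :: "('m, 'n::finite) chart \<Rightarrow> 'n \<Rightarrow> ('m \<Rightarrow> 'b::real_normed_vector) \<Rightarrow> 'm \<Rightarrow> 'b" where
  "pd c i F l = frechet_derivative (F \<circ> param c) (at (snd c l)) (axis i 1)"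

definition smooth_map :: "('m, 'n::finite) chart set \<Rightarrow> ('m \<Rightarrow> 'b::real_normed_vector) \<Rightarrow> bool" where
  "smooth_map A F \<longleftrightarrow> (\<forall>c\<in>A. smooth_on (snd c ` fst c) (F \<circ> param c))"

definition smooth_family ::
  "('m, 'n::finite) chart set \<Rightarrow> real set \<Rightarrow> ('m \<Rightarrow> real \<Rightarrow> 'b::real_normed_vector) \<Rightarrow> bool" where
  "smooth_family A J F \<longleftrightarrow>
     (\<forall>c\<in>A. smooth_on (snd c ` fst c \<times> J) (\<lambda>(u, t). F (param c u) t))"

definition immersion :: "('m, 'n::finite) chart set \<Rightarrow> ('m \<Rightarrow> 'b::real_normed_vector) \<Rightarrow> bool" where
  "immersion A X \<longleftrightarrow> smooth_map A X \<and>
     (\<forall>c\<in>A. \<forall>u\<in>snd c ` fst c. inj (frechet_derivative (X \<circ> param c) (at u)))"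


section \<open>Geometry of an immersed hypersurface\<close>

text \<open>\<open>g\<^sub>i\<^sub>j = \<langle>\<partial>\<^sub>i X, \<partial>\<^sub>j X\<rangle>\<close>; the inverse matrix is \<open>g\<^sup>i\<^sup>j\<close>.\<close>

definition metric ::
  "('m, 'n::finite) chart \<Rightarrow> ('m \<Rightarrow> 'e::real_inner) \<Rightarrow> 'm \<Rightarrow> real ^ 'n ^ 'n" where
  "metric c X l = (\<chi> i j. pd c i X l \<bullet> pd c j X l)"

definition metric_inv ::
  "('m, 'n::finite) chart \<Rightarrow> ('m \<Rightarrow> 'e::real_inner) \<Rightarrow> 'm \<Rightarrow> real ^ 'n ^ 'n" where
  "metric_inv c X l = matrix_inv (metric c X l)"

text \<open>\<open>\<Gamma>\<^sup>k\<^sub>i\<^sub>j = 1/2 \<Sum>\<^sub>r g\<^sup>k\<^sup>r (\<partial>\<^sub>i g\<^sub>j\<^sub>r + \<partial>\<^sub>j g\<^sub>i\<^sub>r - \<partial>\<^sub>r g\<^sub>i\<^sub>j)\<close>\<close>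

definition christoffel ::
  "('m, 'n::finite) chart \<Rightarrow> ('m \<Rightarrow> 'e::real_inner) \<Rightarrow> 'n \<Rightarrow> 'n \<Rightarrow> 'n \<Rightarrow> 'm \<Rightarrow> real" where
  "christoffel c X k i j l =
     1/2 * (\<Sum>r\<in>UNIV. metric_inv c X l $ k $ r *
       (pd c i (\<lambda>p. metric c X p $ j $ r) l + pd c j (\<lambda>p. metric c X p $ i $ r) l
        - pd c r (\<lambda>p. metric c X p $ i $ j) l))"

text \<open>Laplace--Beltrami operator of the induced metric:
  \<open>g\<^sup>i\<^sup>j (\<partial>\<^sub>i\<partial>\<^sub>j F - \<Gamma>\<^sup>k\<^sub>i\<^sub>j \<partial>\<^sub>k F)\<close>, the trace of the covariant Hessian.\<close>

definition laplacian ::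
  "('m, 'n::finite) chart set \<Rightarrow> ('m \<Rightarrow> 'e::real_inner) \<Rightarrow> ('m \<Rightarrow> real) \<Rightarrow> 'm \<Rightarrow> real" where
  "laplacian A X F l = (let c = chart_at A l in
     \<Sum>i\<in>UNIV. \<Sum>j\<in>UNIV. metric_inv c X l $ i $ j *
       (pd c i (pd c j F) l - (\<Sum>k\<in>UNIV. christoffel c X k i j l * pd c k F l)))"

text \<open>Tangential gradient \<open>g\<^sup>i\<^sup>j \<partial>\<^sub>j F \<partial>\<^sub>i X\<close>, a vector of the ambient space.\<close>

definition gradient ::
  "('m, 'n::finite) chart set \<Rightarrow> ('m \<Rightarrow> 'e::real_inner) \<Rightarrow> ('m \<Rightarrow> real) \<Rightarrow> 'm \<Rightarrow> 'e" where
  "gradient A X F l = (let c = chart_at A l in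
     \<Sum>i\<in>UNIV. \<Sum>j\<in>UNIV. (metric_inv c X l $ i $ j * pd c j F l) *\<^sub>R pd c i X l)"

definition unit_normal ::
  "('m, 'n::finite) chart set \<Rightarrow> ('m \<Rightarrow> 'e::real_inner) \<Rightarrow> ('m \<Rightarrow> 'e) \<Rightarrow> bool" where
  "unit_normal A X N \<longleftrightarrow>
     (\<forall>l. norm (N l) = 1) \<and> (\<forall>c\<in>A. \<forall>l\<in>fst c. \<forall>i. N l \<bullet> pd c i X l = 0)"

text \<open>Sum of the principal curvatures, \<open>H = g\<^sup>i\<^sup>j h\<^sub>i\<^sub>j\<close> with \<open>h\<^sub>i\<^sub>j = \<langle>\<partial>\<^sub>i N, \<partial>\<^sub>j X\<rangle>\<close>. With this sign
  \<open>H\<close> is positive on round spheres with outer normal, and \<open>-H N\<close> is the mean curvature vector.\<close>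

definition mean_curvature ::
  "('m, 'n::finite) chart set \<Rightarrow> ('m \<Rightarrow> 'e::real_inner) \<Rightarrow> ('m \<Rightarrow> 'e) \<Rightarrow> 'm \<Rightarrow> real" where
  "mean_curvature A X N l = (let c = chart_at A l in
     \<Sum>i\<in>UNIV. \<Sum>j\<in>UNIV. metric_inv c X l $ i $ j * (pd c i N l \<bullet> pd c j X l))"

text \<open>The Riemannian measure of the induced metric: the Borel measure with density
  \<open>sqrt (det g)\<close> in every chart. This determines it uniquely when \<open>'m\<close> is second countable.\<close>

definition riemannian_measure ::
  "('m::topological_space, 'n::finite) chart set \<Rightarrow> ('m \<Rightarrow> 'e::real_inner) \<Rightarrow> 'm measure \<Rightarrow> bool" where
  "riemannian_measure A X \<mu> \<longleftrightarrow> sets \<mu> = sets borel \<and>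
     (\<forall>c\<in>A. \<forall>B\<in>sets borel. B \<subseteq> fst c \<longrightarrow>
        emeasure \<mu> B =
          (\<integral>\<^sup>+u\<in>snd c ` B. ennreal (sqrt (det (metric c X (param c u)))) \<partial>lborel))"


section \<open>Volume preserving mean curvature flow\<close>

text \<open>\<open>M\<^sub>t\<close> is the image of \<open>\<lambda>l. x l t\<close>; at \<open>t = 0\<close> only continuity of \<open>x\<close> is required.\<close>

definition vp_mcf ::
  "('m::topological_space, 'n::finite) chart set \<Rightarrow> real \<Rightarrow>
   ('m \<Rightarrow> real \<Rightarrow> 'e::euclidean_space) \<Rightarrow> ('m \<Rightarrow> real \<Rightarrow> 'e) \<Rightarrow> bool" where
  "vp_mcf A T x \<nu> \<longleftrightarrow>
     continuous_on (UNIV \<times> {0..<T}) (\<lambda>(l, t). x l t) \<and>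
     smooth_family A {0<..<T} x \<and> smooth_family A {0<..<T} \<nu> \<and>
     (\<forall>t\<in>{0<..<T}. immersion A (\<lambda>l. x l t) \<and> unit_normal A (\<lambda>l. x l t) (\<lambda>l. \<nu> l t)) \<and>
     (\<forall>t\<in>{0<..<T}. \<exists>\<mu>. riemannian_measure A (\<lambda>l. x l t) \<mu> \<and>
        (let H = mean_curvature A (\<lambda>l. x l t) (\<lambda>l. \<nu> l t);
             h = (\<integral>l. H l \<partial>\<mu>) / (\<integral>l. 1 \<partial>\<mu>)
         in \<forall>l. (x l has_vector_derivative - (H l - h) *\<^sub>R \<nu> l t) (at t)))"


section \<open>Non-cylindrical domains\<close>

text \<open>Closures are taken in \<open>\<Omega> \<times> \<real>\<close>; for \<open>V \<subseteq> \<Omega> \<times> (0,T)\<close> this is the closure in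
  \<open>\<Omega> \<times> [0,T]\<close>.\<close>

definition slice :: "real \<Rightarrow> ('m \<times> real) set" where
  "slice t = UNIV \<times> {t}"

definition bdry :: "('m::topological_space \<times> real) set \<Rightarrow> ('m \<times> real) set" where
  "bdry V = closure V - V"

definition parabolic_boundary ::
  "real \<Rightarrow> ('m::topological_space \<times> real) set \<Rightarrow> ('m \<times> real) set" where
  "parabolic_boundary T V = bdry V - slice T"

definition reached_from_below ::
  "('m::topological_space \<times> real) set \<Rightarrow> ('m \<times> real) set \<Rightarrow> bool" where
  "reached_from_below V Z \<longleftrightarrow>
     (\<forall>(l, t)\<in>Z. \<exists>U \<epsilon>. open U \<and> l \<in> U \<and> \<epsilon> > 0 \<and> U \<times> {t - \<epsilon><..<t} \<subseteq> V)"

text \<open>The admissible subsets are closed under unions, so their union is the largest one.\<close>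

definition Z_slice ::
  "('m::topological_space \<times> real) set \<Rightarrow> real \<Rightarrow> ('m \<times> real) set" where
  "Z_slice V t = \<Union>{Z. Z \<subseteq> slice t \<inter> bdry V \<and> openin (top_of_set (bdry V)) Z \<and>
                       reached_from_below V Z}"

definition Z_set ::
  "real \<Rightarrow> ('m::topological_space \<times> real) set \<Rightarrow> ('m \<times> real) set" where
  "Z_set T V = (\<Union>t\<in>{0<..<T}. Z_slice V t)"

definition delta_boundary ::
  "real \<Rightarrow> ('m::topological_space \<times> real) set \<Rightarrow> ('m \<times> real) set" where
  "delta_boundary T V = parabolic_boundary T V - Z_set T V"


section \<open>Functions of class \<open>C\<^sup>2\<^sup>,\<^sup>1\<close>\<close>

text \<open>Twice continuously differentiable in space and once in time: all these derivatives exist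
  on the open set \<open>V\<close> and are jointly continuous there.\<close>

definition C21_on ::
  "('m::topological_space, 'n::finite) chart set \<Rightarrow> ('m \<times> real) set \<Rightarrow> ('m \<times> real \<Rightarrow> real) \<Rightarrow> bool"
where
  "C21_on A V f \<longleftrightarrow>
     continuous_on V f \<and>
     (\<forall>(l, t)\<in>V. (\<lambda>s. f (l, s)) differentiable (at t)) \<and>
     continuous_on V (\<lambda>(l, t). deriv (\<lambda>s. f (l, s)) t) \<and>
     (\<forall>c\<in>A.
        (\<forall>(l, t)\<in>V \<inter> fst c \<times> UNIV.
           ((\<lambda>p. f (p, t)) \<circ> param c) differentiable (at (snd c l)) \<and>
           (\<forall>j. (pd c j (\<lambda>p. f (p, t)) \<circ> param c) differentiable (at (snd c l)))) \<and>
        (\<forall>j. continuous_on (V \<inter> fst c \<times> UNIV) (\<lambda>(l, t). pd c j (\<lambda>p. f (p, t)) l)) \<and>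
        (\<forall>i j. continuous_on (V \<inter> fst c \<times> UNIV)
           (\<lambda>(l, t). pd c i (pd c j (\<lambda>p. f (p, t))) l)))"

end

theory Submission
  imports Defs
begin

text \<open>At a point where \<open>f(\<cdot>, t)\<close> has a spatial maximum the tangential gradient vanishes, so the drift
  term \<open>\<langle>a, \<nabla>f\<rangle>\<close> drops out, and \<open>\<Delta>f \<le> 0\<close>, because the Laplacian is there the trace of
  a nonpositive Hessian against the positive definite inverse metric. The differential inequality
  leaves \<open>\<partial>\<^sub>t f \<le> 0\<close>. Therefore the penalised function \<open>g(l, t) = f(l, t) - \<epsilon> t\<close>, with \<open>\<epsilon> > 0\<close>, cannot
  attain a maximum over \<open>V \<inter> {time \<le> t\<^sub>0}\<close> at a point of \<open>V\<close>: it would have to satisfy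
  \<open>\<partial>\<^sub>t f \<ge> \<epsilon>\<close> there. This is \<open>no_time_penalised_max_in_domain\<close>.

  Consequently the maximum of \<open>g\<close> over the compact set \<open>closure V \<inter> {time \<le> t\<^sub>0}\<close> lies on \<open>\<Gamma>\<^sub>V\<close> when
  \<open>t\<^sub>0 < T\<close>. To exclude \<open>Z\<^sub>V\<close>, where \<open>f\<close> need not be differentiable, the maximum is approximated from
  below in time rather than perturbed, as a spatial perturbation would bring back a nonzero
  gradient, paired with \<open>a\<close>, which may be unbounded near \<open>Z\<^sub>V\<close>. Suppose that all maximum points
  lie in \<open>Z\<^sub>V\<close>, and let \<open>t\<^sub>*\<close> be the earliest of their times. As \<open>Z\<^sub>V\<close> is reached from below, \<open>g\<close> comes
  close to its maximum at times \<open>s < t\<^sub>*\<close>, so as \<open>s \<rightarrow> t\<^sub>*\<close> the maximisers of \<open>g\<close> over the times up to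
  \<open>s\<close> accumulate at a maximum point, which has time \<open>t\<^sub>*\<close>. Everything near that point at times just
  below \<open>t\<^sub>*\<close> lies in \<open>V\<close>, including some of these maximisers, which is impossible. This is
  \<open>exists_delta_boundary_ge\<close>. Letting \<open>\<epsilon> \<rightarrow> 0\<close> gives \<open>sup\<^sub>V f \<le> sup\<^sub>\<delta> f\<close>, and the estimate by
  \<open>\<Gamma>\<^sub>V\<close> follows from \<open>\<delta>\<^sub>V \<subseteq> \<Gamma>\<^sub>V\<close>.\<close>


section \<open>The second derivative test\<close>

lemma second_derivative_nonpos_at_max:
  fixes h h' :: "real \<Rightarrow> real"
  assumes "0 < r"
    and h: "\<And>s. \<bar>s\<bar> < r \<Longrightarrow> (h has_real_derivative h' s) (at s)"
    and h2: "(h' has_real_derivative D) (at 0)"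
    and max: "\<And>s. \<bar>s\<bar> < r \<Longrightarrow> h s \<le> h 0"
  shows "D \<le> 0"
proof (rule ccontr)
  assume "\<not> D \<le> 0"
  then obtain d where d: "d > 0" "\<And>s. 0 < s \<Longrightarrow> s < d \<Longrightarrow> h' 0 < h' (0 + s)"
    using DERIV_pos_inc_right[OF h2] by auto
  have "h' 0 = 0"
    using DERIV_local_max[OF h[of 0] \<open>0 < r\<close>] max \<open>0 < r\<close> by simp
  define b where "b = min r d / 2"
  have b: "0 < b" "b < r" "b < d"
    using \<open>0 < r\<close> d(1) by (auto simp: b_def min_def)
  obtain z where z: "0 < z" "z < b" "h b - h 0 = (b - 0) * h' z"
    using MVT2[of 0 b h h'] h b by auto
  have "0 < (b - 0) * h' z"
    using z b d(2)[of z] \<open>h' 0 = 0\<close> by simp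
  with z max[of b] b show False by simp
qed

text \<open>The functions \<open>\<psi> j\<close> are the partial derivatives of \<open>\<phi>\<close>, and \<open>\<psi>' j (axis i 1)\<close> is the entry
  \<open>\<partial>\<^sub>i\<partial>\<^sub>j \<phi>\<close> of the Hessian. The Hessian form is evaluated by restricting \<open>\<phi>\<close> to lines through the
  maximum point.\<close>

lemma
  fixes \<phi> :: "real ^ 'n::finite \<Rightarrow> real"
  assumes "open D" "u\<^sub>0 \<in> D"
    and max: "\<And>u. u \<in> D \<Longrightarrow> \<phi> u \<le> \<phi> u\<^sub>0"
    and d1: "\<And>u. u \<in> D \<Longrightarrow> (\<phi> has_derivative (\<lambda>v. \<Sum>j\<in>UNIV. v $ j * \<psi> j u)) (at u)"
  shows partial_eq_0_at_max: "\<psi> j u\<^sub>0 = 0"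
    and hessian_nonpos_at_max: "(\<And>j. (\<psi> j has_derivative \<psi>' j) (at u\<^sub>0)) \<Longrightarrow>
      (\<Sum>i\<in>UNIV. \<Sum>j\<in>UNIV. v $ i * v $ j * \<psi>' j (axis i 1)) \<le> 0"
proof -
  have "(\<lambda>v. \<Sum>j\<in>UNIV. v $ j * \<psi> j u\<^sub>0) = (\<lambda>v. 0)"
    using differential_zero_maxmin[OF \<open>u\<^sub>0 \<in> D\<close> \<open>open D\<close> d1[OF \<open>u\<^sub>0 \<in> D\<close>]] max by blast
  then have "(\<Sum>i\<in>UNIV. axis j 1 $ i * \<psi> i u\<^sub>0) = 0"
    by meson
  then show "\<psi> j u\<^sub>0 = 0"
    by (simp add: axis_def if_distrib[of "\<lambda>x. x * _"] cong: if_cong)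
next
  assume d2: "\<And>j. (\<psi> j has_derivative \<psi>' j) (at u\<^sub>0)"
  (* r is chosen so that the segment u0 + s v with |s| < r stays in D, also when v = 0. *)
  obtain e where e: "e > 0" "ball u\<^sub>0 e \<subseteq> D"
    using \<open>open D\<close> \<open>u\<^sub>0 \<in> D\<close> open_contains_ball by blast
  define r where "r = e / (norm v + 1)"
  have "r > 0"
    using e by (simp add: r_def add_nonneg_pos)
  have in_D: "u\<^sub>0 + s *\<^sub>R v \<in> D" if "\<bar>s\<bar> < r" for s
  proof -
    have "norm (s *\<^sub>R v) \<le> \<bar>s\<bar> * (norm v + 1)"
      by (simp add: mult_left_mono)
    also have "\<dots> < r * (norm v + 1)"
      using that by (intro mult_strict_right_mono) (auto simp: add_nonneg_pos)
    also have "\<dots> = e"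
      by (simp add: r_def add_nonneg_eq_0_iff)
    finally show ?thesis
      using e by (auto simp: dist_norm)
  qed
  have line: "((\<lambda>s. u\<^sub>0 + s *\<^sub>R v) has_derivative (\<lambda>h. h *\<^sub>R v)) (at s)" for s :: real
    by (auto intro!: derivative_eq_intros)
  define h' where "h' s = (\<Sum>j\<in>UNIV. v $ j * \<psi> j (u\<^sub>0 + s *\<^sub>R v))" for s
  have h: "((\<lambda>s. \<phi> (u\<^sub>0 + s *\<^sub>R v)) has_real_derivative h' s) (at s)" if "\<bar>s\<bar> < r" for s
    using has_derivative_compose[OF line d1[OF in_D[OF that]]]
    unfolding has_field_derivative_def
    by (rule has_derivative_eq_rhs) (auto simp: h'_def fun_eq_iff sum_distrib_left mult_ac)
  have lin: "\<psi>' j v = (\<Sum>i\<in>UNIV. v $ i * \<psi>' j (axis i 1))" for j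
  proof -
    have l: "linear (\<psi>' j)"
      using d2 has_derivative_linear by blast
    have "\<psi>' j v = \<psi>' j (\<Sum>i\<in>UNIV. v $ i *\<^sub>R axis i 1)"
      by (metis basis_expansion scalar_mult_eq_scaleR)
    then show ?thesis
      by (simp add: linear_sum[OF l] linear_scale[OF l])
  qed
  have "((\<lambda>s. \<psi> j (u\<^sub>0 + s *\<^sub>R v)) has_real_derivative \<psi>' j v) (at 0)" for j
    unfolding has_field_derivative_def
  proof (rule has_derivative_eq_rhs[OF has_derivative_compose[OF line]])
    show "(\<psi> j has_derivative \<psi>' j) (at (u\<^sub>0 + 0 *\<^sub>R v))"
      using d2 by simp
    show "(\<lambda>h. \<psi>' j (h *\<^sub>R v)) = (*) (\<psi>' j v)"
      by (simp add: fun_eq_iff linear_scale[OF has_derivative_linear[OF d2]])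
  qed
  then have "(h' has_real_derivative (\<Sum>j\<in>UNIV. v $ j * \<psi>' j v)) (at 0)"
    unfolding h'_def by (auto intro!: DERIV_sum DERIV_cmult)
  then have "(\<Sum>j\<in>UNIV. v $ j * \<psi>' j v) \<le> 0"
    using second_derivative_nonpos_at_max[OF \<open>r > 0\<close> h] max in_D by simp
  moreover have "(\<Sum>j\<in>UNIV. v $ j * \<psi>' j v) =
      (\<Sum>i\<in>UNIV. \<Sum>j\<in>UNIV. v $ i * v $ j * \<psi>' j (axis i 1))"
    unfolding lin sum_distrib_left by (subst sum.swap) (simp add: mult_ac)
  ultimately show "(\<Sum>i\<in>UNIV. \<Sum>j\<in>UNIV. v $ i * v $ j * \<psi>' j (axis i 1)) \<le> 0"
    by simp
qed


section \<open>Traces against the inverse of a Gram matrix\<close>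

lemma gram_invertible:
  fixes e :: "'n::finite \<Rightarrow> 'e::real_inner"
  assumes inj: "\<And>v :: real ^ 'n. (\<Sum>i\<in>UNIV. v $ i *\<^sub>R e i) = 0 \<Longrightarrow> v = 0"
  shows "invertible (\<chi> i j. e i \<bullet> e j)"
proof -
  have "v = 0" if "(\<chi> i j. e i \<bullet> e j) *v v = 0" for v :: "real ^ 'n"
  proof (rule inj)
    let ?w = "\<Sum>i\<in>UNIV. v $ i *\<^sub>R e i"
    have "e i \<bullet> ?w = ((\<chi> i j. e i \<bullet> e j) *v v) $ i" for i
      by (simp add: matrix_vector_mult_def inner_sum_right mult.commute)
    then have "e i \<bullet> ?w = 0" for i
      using that by simp
    then have "?w \<bullet> ?w = 0"
      by (subst inner_sum_left) simp
    then show "?w = 0" by simp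
  qed
  then show ?thesis
    using invertible_left_inverse matrix_left_invertible_ker by blast
qed

text \<open>Let \<open>d i = \<Sum>\<^sub>j P\<^sub>i\<^sub>j e j\<close> be the dual vectors, characterised by \<open>d i \<bullet> e k = \<delta>\<^sub>i\<^sub>k\<close>. Then
  \<open>P\<^sub>i\<^sub>j = d i \<bullet> d j\<close>, and expanding this inner product in the standard basis of the ambient space
  writes \<open>P\<close> as a sum of rank one matrices \<open>v v\<^sup>T\<close>. The trace thereby becomes a sum of values of the
  quadratic form \<open>H\<close>.\<close>

lemma trace_gram_inv_nonpos:
  fixes e :: "'n::finite \<Rightarrow> 'e::euclidean_space" and P :: "real ^ 'n ^ 'n"
  assumes inv: "P ** (\<chi> i j. e i \<bullet> e j) = mat 1"
    and H: "\<And>v :: real ^ 'n. (\<Sum>i\<in>UNIV. \<Sum>j\<in>UNIV. v $ i * v $ j * H i j) \<le> 0"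
  shows "(\<Sum>i\<in>UNIV. \<Sum>j\<in>UNIV. P $ i $ j * H i j) \<le> 0"
proof -
  define d where "d i = (\<Sum>j\<in>UNIV. P $ i $ j *\<^sub>R e j)" for i
  have dual: "d i \<bullet> e k = (if i = k then 1 else 0)" for i k
  proof -
    have "d i \<bullet> e k = (P ** (\<chi> i j. e i \<bullet> e j)) $ i $ k"
      by (simp add: d_def matrix_matrix_mult_def inner_sum_left)
    then show ?thesis
      using inv by (simp add: mat_def)
  qed
  have P: "P $ i $ j = d i \<bullet> d j" for i j
  proof -
    have "d j \<bullet> d i = (\<Sum>k\<in>UNIV. P $ i $ k * (d j \<bullet> e k))"
      by (subst d_def[of i]) (simp add: inner_sum_right)
    also have "\<dots> = P $ i $ j"
      by (simp add: dual if_distrib cong: if_cong)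
    finally show ?thesis by (simp add: inner_commute)
  qed
  have "(\<Sum>i\<in>UNIV. \<Sum>j\<in>UNIV. P $ i $ j * H i j)
      = (\<Sum>i\<in>UNIV. \<Sum>j\<in>UNIV. \<Sum>b\<in>Basis. (d i \<bullet> b) * (d j \<bullet> b) * H i j)"
    unfolding P by (subst euclidean_inner) (simp add: sum_distrib_right)
  also have "\<dots> = (\<Sum>i\<in>UNIV. \<Sum>b\<in>Basis. \<Sum>j\<in>UNIV. (d i \<bullet> b) * (d j \<bullet> b) * H i j)"
    by (intro sum.cong refl sum.swap)
  also have "\<dots> = (\<Sum>b\<in>Basis. \<Sum>i\<in>UNIV. \<Sum>j\<in>UNIV. (d i \<bullet> b) * (d j \<bullet> b) * H i j)"
    by (rule sum.swap)
  also have "\<dots> \<le> 0"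
  proof (rule sum_nonpos)
    fix b :: 'e
    show "(\<Sum>i\<in>UNIV. \<Sum>j\<in>UNIV. (d i \<bullet> b) * (d j \<bullet> b) * H i j) \<le> 0"
      using H[of "\<chi> i. d i \<bullet> b"] by simp
  qed
  finally show ?thesis .
qed

section \<open>Gradient and Laplacian at a spatial maximum\<close>

lemma chart_at:
  assumes "smooth_atlas A"
  shows "chart_at A l \<in> A" "l \<in> fst (chart_at A l)"
proof -
  have "\<exists>c. c \<in> A \<and> l \<in> fst c"
    using assms unfolding smooth_atlas_def by blast
  then have "chart_at A l \<in> A \<and> l \<in> fst (chart_at A l)"
    unfolding chart_at_def by (rule someI_ex)
  then show "chart_at A l \<in> A" "l \<in> fst (chart_at A l)"
    by auto
qed

lemma frechet_derivative_eq_sum_partials: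
  fixes F :: "real ^ 'n::finite \<Rightarrow> 'b::real_normed_vector"
  assumes "F differentiable (at u)"
  shows "frechet_derivative F (at u) v =
    (\<Sum>i\<in>UNIV. v $ i *\<^sub>R frechet_derivative F (at u) (axis i 1))"
proof -
  have l: "linear (frechet_derivative F (at u))"
    using assms by (rule linear_frechet_derivative)
  have "frechet_derivative F (at u) v = frechet_derivative F (at u) (\<Sum>i\<in>UNIV. v $ i *\<^sub>R axis i 1)"
    by (metis basis_expansion scalar_mult_eq_scaleR)
  then show ?thesis
    by (simp add: linear_sum[OF l] linear_scale[OF l])
qed

lemma metric_inv_mult_metric:
  fixes X :: "'m \<Rightarrow> 'e::euclidean_space" and c :: "('m, 'n::finite) chart"
  assumes "immersion A X" "c \<in> A" "l \<in> fst c"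
  shows "metric_inv c X l ** metric c X l = mat 1"
proof -
  let ?D = "frechet_derivative (X \<circ> param c) (at (snd c l))"
  have inj: "inj ?D"
    using assms unfolding immersion_def by blast
  have "Ck_on (Suc 0) (snd c ` fst c) (X \<circ> param c)"
    using assms unfolding immersion_def smooth_map_def smooth_on_def by blast
  then have "(X \<circ> param c) differentiable (at (snd c l))"
    using assms(3) by auto
  note D = frechet_derivative_eq_sum_partials[OF this] linear_frechet_derivative[OF this]
  have "invertible (metric c X l)"
    unfolding metric_def
  proof (rule gram_invertible)
    fix v :: "real ^ 'n"
    assume "(\<Sum>i\<in>UNIV. v $ i *\<^sub>R pd c i X l) = 0"
    then have "?D v = 0"
      unfolding pd_def using D(1)[of v] by simp
    then show "v = 0"
      using inj D(2) linear_injective_0 by blast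
  qed
  then show ?thesis
    unfolding metric_inv_def matrix_inv_def invertible_def
    by (rule someI_ex[THEN conjunct2])
qed

text \<open>Since all first partial derivatives vanish at the maximum, the Christoffel terms of the Laplacian
  disappear and only \<open>g\<^sup>i\<^sup>j \<partial>\<^sub>i\<partial>\<^sub>j F\<close> remains.\<close>

lemma
  fixes A :: "('m::topological_space, 'n::finite) chart set"
    and X :: "'m \<Rightarrow> 'e::euclidean_space"
  assumes atlas: "smooth_atlas A" and imm: "immersion A X"
    and W: "open W" "l \<in> W" and max: "\<And>p. p \<in> W \<Longrightarrow> F p \<le> F l"
    and F1: "\<And>c p. c \<in> A \<Longrightarrow> p \<in> W \<inter> fst c \<Longrightarrow> (F \<circ> param c) differentiable (at (snd c p))"
    and F2: "\<And>c p j. c \<in> A \<Longrightarrow> p \<in> W \<inter> fst c \<Longrightarrow>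
        (pd c j F \<circ> param c) differentiable (at (snd c p))"
  shows gradient_eq_0_at_max: "gradient A X F l = 0"
    and laplacian_nonpos_at_max: "laplacian A X F l \<le> 0"
proof -
  define c where "c = chart_at A l"
  have c: "c \<in> A" "l \<in> fst c"
    using chart_at[OF atlas] by (auto simp: c_def)
  have hom: "homeomorphism (fst c) (snd c ` fst c) (snd c) (param c)"
    and op: "open (fst c)" "open (snd c ` fst c)"
    using atlas c unfolding smooth_atlas_def by blast+
  have par: "param c (snd c p) = p" if "p \<in> fst c" for p
    using hom that by (auto simp: homeomorphism_def)
  define D where "D = snd c ` (W \<inter> fst c)"
  have "openin (top_of_set (snd c ` fst c)) D"
    unfolding D_def
    by (rule homeomorphism_imp_open_map[OF hom]) (use W in \<open>auto simp: openin_open\<close>)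
  then have D: "open D"
    using op openin_open_eq by blast
  have u\<^sub>0: "snd c l \<in> D"
    using c W by (auto simp: D_def)
  let ?\<psi> = "\<lambda>j. pd c j F \<circ> param c"
  have d1: "((F \<circ> param c) has_derivative (\<lambda>v. \<Sum>j\<in>UNIV. v $ j * ?\<psi> j u)) (at u)"
    if "u \<in> D" for u
  proof -
    obtain p where p: "p \<in> W \<inter> fst c" "u = snd c p"
      using \<open>u \<in> D\<close> by (auto simp: D_def)
    have diff: "(F \<circ> param c) differentiable (at u)"
      using F1[OF c(1) p(1)] p(2) by simp
    have "frechet_derivative (F \<circ> param c) (at u) = (\<lambda>v. \<Sum>j\<in>UNIV. v $ j * ?\<psi> j u)"
    proof
      fix v
      show "frechet_derivative (F \<circ> param c) (at u) v = (\<Sum>j\<in>UNIV. v $ j * ?\<psi> j u)"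
        using frechet_derivative_eq_sum_partials[OF diff, of v] p par by (simp add: pd_def)
    qed
    with diff show ?thesis
      using frechet_derivative_works by metis
  qed
  have maxD: "(F \<circ> param c) u \<le> (F \<circ> param c) (snd c l)" if "u \<in> D" for u
    using that max c par by (auto simp: D_def)
  have grad: "pd c j F l = 0" for j
    using partial_eq_0_at_max[OF D u\<^sub>0 maxD d1, of j] par[OF c(2)] by simp
  then show "gradient A X F l = 0"
    by (simp add: gradient_def Let_def flip: c_def)
  have d2: "(?\<psi> j has_derivative frechet_derivative (?\<psi> j) (at (snd c l))) (at (snd c l))" for j
    using F2[OF c(1), of l j] c W frechet_derivative_works by blast
  have "(\<Sum>i\<in>UNIV. \<Sum>j\<in>UNIV. metric_inv c X l $ i $ j * pd c i (pd c j F) l) \<le> 0"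
  proof (rule trace_gram_inv_nonpos)
    show "metric_inv c X l ** (\<chi> i j. pd c i X l \<bullet> pd c j X l) = mat 1"
      using metric_inv_mult_metric[OF imm c] by (simp add: metric_def)
    show "(\<Sum>i\<in>UNIV. \<Sum>j\<in>UNIV. v $ i * v $ j * pd c i (pd c j F) l) \<le> 0" for v :: "real ^ 'n"
      using hessian_nonpos_at_max[OF D u\<^sub>0 maxD d1 d2, of v] by (simp add: pd_def[of c _ "pd c _ F"])
  qed
  then show "laplacian A X F l \<le> 0"
    by (simp add: laplacian_def Let_def grad flip: c_def)
qed

section \<open>Maxima over non-cylindrical domains\<close>

text \<open>Otherwise \<open>l\<close> would be a spatial maximum at time \<open>t\<close>, whence \<open>\<partial>\<^sub>t f \<le> 0\<close>, while the penalised
  function would be strictly decreasing at \<open>t\<close> and hence larger just before \<open>t\<close>. Only times up to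
  \<open>t\<close> are compared, so that the lemma applies to every truncation \<open>{time \<le> s}\<close> with \<open>s \<ge> t\<close>.\<close>

lemma no_time_penalised_max_in_domain:
  fixes A :: "('m::topological_space, 'n::finite) chart set"
    and X :: "'m \<Rightarrow> real \<Rightarrow> 'e::euclidean_space"
  assumes atlas: "smooth_atlas A" and "open V" and C21: "C21_on A V f"
    and "(l, t) \<in> V" and "immersion A (\<lambda>p. X p t)"
    and ineq: "deriv (\<lambda>s. f (l, s)) t - laplacian A (\<lambda>p. X p t) (\<lambda>p. f (p, t)) l
             \<le> a \<bullet> gradient A (\<lambda>p. X p t) (\<lambda>p. f (p, t)) l"
    and "0 < \<epsilon>"
  shows "\<exists>p\<in>V. snd p \<le> t \<and> f (l, t) - \<epsilon> * t < f p - \<epsilon> * snd p"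
proof (rule ccontr)
  assume no_larger: "\<not> ?thesis"
  have max: "f (p, s) - \<epsilon> * s \<le> f (l, t) - \<epsilon> * t" if "(p, s) \<in> V" "s \<le> t" for p s
  proof -
    have "\<not> (snd (p, s) \<le> t \<and> f (l, t) - \<epsilon> * t < f (p, s) - \<epsilon> * snd (p, s))"
      using no_larger \<open>(p, s) \<in> V\<close> by blast
    then show ?thesis
      using \<open>s \<le> t\<close> by simp
  qed
  obtain U I where UI: "open U" "open I" "l \<in> U" "t \<in> I" "U \<times> I \<subseteq> V"
    by (rule open_prod_elim[OF \<open>open V\<close> \<open>(l, t) \<in> V\<close>]) simp
  have F: "((\<lambda>p. f (p, t)) \<circ> param c) differentiable (at (snd c p))"
      "(pd c j (\<lambda>p. f (p, t)) \<circ> param c) differentiable (at (snd c p))"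
    if "c \<in> A" "p \<in> U \<inter> fst c" for c p j
  proof -
    have "\<forall>(l, t)\<in>V \<inter> fst c \<times> UNIV.
        ((\<lambda>p. f (p, t)) \<circ> param c) differentiable (at (snd c l)) \<and>
        (\<forall>j. (pd c j (\<lambda>p. f (p, t)) \<circ> param c) differentiable (at (snd c l)))"
      using C21[unfolded C21_on_def, THEN conjunct2, THEN conjunct2, THEN conjunct2,
          THEN bspec, OF \<open>c \<in> A\<close>] by (rule conjunct1)
    moreover have "(p, t) \<in> V \<inter> fst c \<times> UNIV"
      using that UI by auto
    ultimately have "((\<lambda>p. f (p, t)) \<circ> param c) differentiable (at (snd c p)) \<and>
        (\<forall>j. (pd c j (\<lambda>p. f (p, t)) \<circ> param c) differentiable (at (snd c p)))"
      by (rule bspec[where P = "case_prod _", THEN iffD1[OF case_prod_conv]])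
    then show "((\<lambda>p. f (p, t)) \<circ> param c) differentiable (at (snd c p))"
      "(pd c j (\<lambda>p. f (p, t)) \<circ> param c) differentiable (at (snd c p))"
      by blast+
  qed
  have spatial_max: "f (p, t) \<le> f (l, t)" if "p \<in> U" for p
    using max[of p t] UI that by auto
  have "gradient A (\<lambda>p. X p t) (\<lambda>p. f (p, t)) l = 0"
    by (rule gradient_eq_0_at_max[OF atlas assms(5) UI(1,3) spatial_max F])
  moreover have "laplacian A (\<lambda>p. X p t) (\<lambda>p. f (p, t)) l \<le> 0"
    by (rule laplacian_nonpos_at_max[OF atlas assms(5) UI(1,3) spatial_max F])
  ultimately have "deriv (\<lambda>s. f (l, s)) t \<le> 0"
    using ineq by simp
  moreover have "((\<lambda>s. f (l, s)) has_real_derivative deriv (\<lambda>s. f (l, s)) t) (at t)"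
    using bspec[OF C21[unfolded C21_on_def, THEN conjunct2, THEN conjunct1] \<open>(l, t) \<in> V\<close>]
    by (simp add: DERIV_deriv_iff_real_differentiable)
  ultimately have "((\<lambda>s. f (l, s) - \<epsilon> * s) has_real_derivative deriv (\<lambda>s. f (l, s)) t - \<epsilon>) (at t)"
    and "deriv (\<lambda>s. f (l, s)) t - \<epsilon> < 0"
    using \<open>0 < \<epsilon>\<close> by (auto intro!: derivative_eq_intros)
  then obtain d where d: "d > 0" "\<And>h. 0 < h \<Longrightarrow> h < d \<Longrightarrow>
      f (l, t) - \<epsilon> * t < f (l, t - h) - \<epsilon> * (t - h)"
    using DERIV_neg_dec_left[of "\<lambda>s. f (l, s) - \<epsilon> * s" _ t] by blast
  obtain e where e: "e > 0" "ball t e \<subseteq> I"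
    using UI open_contains_ball by blast
  define h where "h = min d e / 2"
  have h: "0 < h" "h < d" "h < e"
    using d e by (auto simp: h_def min_def)
  then have "t - h \<in> I"
    using e by (auto simp: dist_real_def)
  then have "(l, t - h) \<in> V"
    using UI by blast
  with max[of l "t - h"] d(2)[of h] h show False
    by simp
qed

text \<open>The step from the interior to the boundary is purely topological. Maximisers over truncations in
  time exist by compactness and are not in \<open>V\<close>. Points of \<open>Z\<^sub>V\<close> are excluded by approaching the first
  maximum time from below, since maximisers accumulating at such a point would enter \<open>V\<close>.\<close>

lemma exists_delta_boundary_ge:
  fixes V :: "('m::{t2_space, second_countable_topology} \<times> real) set"
    and g :: "'m \<times> real \<Rightarrow> real"
  assumes "compact (UNIV :: 'm set)" and V: "V \<subseteq> UNIV \<times> {0<..<T}"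
    and g: "continuous_on (closure V) g"
    and up: "\<And>q. q \<in> V \<Longrightarrow> \<exists>p\<in>V. snd p \<le> snd q \<and> g q < g p"
    and "p \<in> V"
  shows "\<exists>d\<in>delta_boundary T V. g p \<le> g d"
proof (rule ccontr)
  assume "\<not> ?thesis"
  then have delta: "g d < g p" if "d \<in> delta_boundary T V" for d
    using that by force
  have clV: "closure V \<subseteq> UNIV \<times> {0..T}"
    by (rule closure_minimal) (use V in \<open>auto intro!: closed_Times\<close>)
  define K where "K s = closure V \<inter> UNIV \<times> {..s}" for s
  have K: "compact (K s)" for s
  proof -
    have "K s = UNIV \<times> {0..T} \<inter> (closure V \<inter> UNIV \<times> {..s})"
      using clV by (auto simp: K_def)
    moreover have "compact ((UNIV :: 'm set) \<times> {0..T})"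
      using assms(1) by (intro compact_Times) auto
    ultimately show ?thesis
      by (simp add: compact_Int_closed closed_Int closed_Times)
  qed
  have gK: "continuous_on (K s) g" for s
    by (rule continuous_on_subset[OF g]) (auto simp: K_def)
  have not_V: "q \<notin> V" if "q \<in> K s" "\<And>r. r \<in> K s \<Longrightarrow> g r \<le> g q" for q s
  proof
    assume "q \<in> V"
    then obtain r where "r \<in> V" "snd r \<le> snd q" "g q < g r"
      using up by blast
    moreover have "r \<in> K s"
      using that(1) \<open>r \<in> V\<close> \<open>snd r \<le> snd q\<close> closure_subset by (auto simp: K_def mem_Times_iff)
    ultimately show False
      using that(2)[of r] by simp
  qed
  have pT: "snd p < T"
    using \<open>p \<in> V\<close> V by auto
  (* The time of p is less than T, so truncating there removes the slice T. A point outside V with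
     value at least g p therefore lies on the parabolic boundary, and then in Z, as g < g p on
     the delta boundary. *)
  have below: "\<exists>U \<epsilon>. open U \<and> fst q \<in> U \<and> \<epsilon> > 0 \<and> U \<times> {snd q - \<epsilon><..<snd q} \<subseteq> V"
    if "q \<in> K (snd p)" "q \<notin> V" "g p \<le> g q" for q
  proof -
    have "q \<in> parabolic_boundary T V"
      using that pT by (auto simp: K_def parabolic_boundary_def bdry_def slice_def)
    then have "q \<in> Z_set T V"
      using delta[of q] that(3) by (auto simp: delta_boundary_def)
    then obtain Z where "q \<in> Z" "reached_from_below V Z"
      by (auto simp: Z_set_def Z_slice_def)
    then show ?thesis
      unfolding reached_from_below_def by (cases q) fastforce
  qed
  have pK: "p \<in> K (snd p)"
    using \<open>p \<in> V\<close> closure_subset by (auto simp: K_def mem_Times_iff)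
  then obtain q\<^sub>0 where q\<^sub>0: "q\<^sub>0 \<in> K (snd p)" "\<And>r. r \<in> K (snd p) \<Longrightarrow> g r \<le> g q\<^sub>0"
    using continuous_attains_sup[OF K _ gK, of "snd p"] by blast
  (* The maximum points, and among them one, q, of least time. *)
  define S where "S = {q \<in> K (snd p). g q = g q\<^sub>0}"
  have "compact S"
  proof -
    have "closedin (top_of_set (K (snd p))) S"
      unfolding S_def by (intro continuous_closedin_preimage_constant gK)
    then show ?thesis
      using K closedin_compact by blast
  qed
  moreover have "q\<^sub>0 \<in> S"
    using q\<^sub>0 by (simp add: S_def)
  ultimately obtain q where q: "q \<in> S" "\<And>r. r \<in> S \<Longrightarrow> snd q \<le> snd r"
    using continuous_attains_inf[of S snd] continuous_on_snd[OF continuous_on_id] by blast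
  have q_max: "g r \<le> g q" if "r \<in> K (snd p)" for r
    using q\<^sub>0 q that by (simp add: S_def)
  have qK: "q \<in> K (snd p)"
    using q by (simp add: S_def)
  obtain U \<epsilon> where U: "fst q \<in> U" "\<epsilon> > 0" "U \<times> {snd q - \<epsilon><..<snd q} \<subseteq> V"
    using below[OF qK] not_V[OF qK q_max] q_max[OF pK] by blast
  (* The denominator is k + 2 and not k + 1 because the interval below q is open, and s 0 must
     lie in it. *)
  define s where "s k = snd q - \<epsilon> / (real k + 2)" for k
  have s_less: "s k < snd q" for k
    using U by (simp add: s_def)
  have "\<epsilon> / (real k + 2) < \<epsilon>" for k
    using U by (simp add: field_simps add_pos_nonneg)
  then have s_V: "(fst q, s k) \<in> V" for k
    using U s_less[of k] by (auto simp: s_def intro!: subsetD[OF U(3)])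
  have "(\<lambda>k. \<epsilon> / real (k + 2)) \<longlonglongrightarrow> 0"
    by (rule LIMSEQ_ignore_initial_segment[OF lim_const_over_n])
  from tendsto_diff[OF tendsto_const[of "snd q"] this] have s_lim: "s \<longlonglongrightarrow> snd q"
    by (simp add: s_def[abs_def] add.commute)
  have s_K: "(fst q, s k) \<in> K (s k)" for k
    using s_V[of k] closure_subset by (auto simp: K_def)
  have "\<exists>r. r \<in> K (s k) \<and> (\<forall>r'\<in>K (s k). g r' \<le> g r)" for k
    using continuous_attains_sup[OF K _ gK, of "s k"] s_K[of k] by blast
  then obtain r where r: "\<And>k. r k \<in> K (s k)" "\<And>k r'. r' \<in> K (s k) \<Longrightarrow> g r' \<le> g (r k)"
    by metis
  have K_mono: "K (s k) \<subseteq> K (snd p)" for k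
    using s_less[of k] qK by (auto simp: K_def mem_Times_iff)
  (* Maximisers over times up to s k accumulate at a maximum point z, no earlier than q by the
     choice of q. As z is in Z, some of these maximisers lie in V. *)
  obtain z \<sigma> where lim: "z \<in> K (snd p)" "strict_mono \<sigma>" "(r \<circ> \<sigma>) \<longlonglongrightarrow> z"
    using compact_imp_seq_compact[OF K[of "snd p"]] r(1) K_mono
    unfolding seq_compact_def by (metis subsetD)
  have s\<sigma>: "(s \<circ> \<sigma>) \<longlonglongrightarrow> snd q"
    using s_lim lim(2) by (rule LIMSEQ_subseq_LIMSEQ)
  have gr: "(\<lambda>k. g ((r \<circ> \<sigma>) k)) \<longlonglongrightarrow> g z"
    using lim r(1) K_mono
    by (intro continuous_on_tendsto_compose[OF gK[of "snd p"] lim(3)] always_eventually) auto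
  have "(\<lambda>k. g (fst q, (s \<circ> \<sigma>) k)) \<longlonglongrightarrow> g q"
  proof (rule continuous_on_tendsto_compose[OF g])
    show "(\<lambda>k. (fst q, (s \<circ> \<sigma>) k)) \<longlonglongrightarrow> q"
      using tendsto_Pair[OF tendsto_const[of "fst q"] s\<sigma>] by simp
    show "q \<in> closure V"
      using qK by (simp add: K_def)
    show "\<forall>\<^sub>F k in sequentially. (fst q, (s \<circ> \<sigma>) k) \<in> closure V"
      using s_V closure_subset by (intro always_eventually) auto
  qed
  then have "g q \<le> g z"
    by (rule LIMSEQ_le[OF _ gr]) (use r(2) s_K in auto)
  then have r_max: "g r' \<le> g z" if "r' \<in> K (snd p)" for r'
    using q_max[OF that] by simp
  have "z \<in> S"
    using r_max[OF q\<^sub>0(1)] q\<^sub>0(2)[OF lim(1)] lim(1) by (simp add: S_def)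
  then have "snd q \<le> snd z"
    using q by blast
  obtain W \<eta> where W: "open W" "fst z \<in> W" "\<eta> > 0" "W \<times> {snd z - \<eta><..<snd z} \<subseteq> V"
    using below[OF lim(1)] not_V[OF lim(1) r_max] r_max[OF pK] by blast
  have "open (W \<times> {snd z - \<eta><..})"
    using W by (intro open_Times) auto
  then have "\<forall>\<^sub>F k in sequentially. (r \<circ> \<sigma>) k \<in> W \<times> {snd z - \<eta><..}"
    by (rule topological_tendstoD[OF lim(3)]) (use W in \<open>auto simp: mem_Times_iff\<close>)
  then obtain k where k: "r (\<sigma> k) \<in> W \<times> {snd z - \<eta><..}"
    unfolding eventually_sequentially comp_def by blast
  have "snd (r (\<sigma> k)) < snd z"
    using r(1)[of "\<sigma> k"] s_less[of "\<sigma> k"] \<open>snd q \<le> snd z\<close> by (auto simp: K_def)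
  with k W have "r (\<sigma> k) \<in> V"
    by (auto simp: mem_Times_iff intro!: subsetD[OF W(4)])
  then show False
    using not_V[OF r(1) r(2)] by blast
qed

section \<open>The maximum principle\<close>

theorem proposition3p1:
  fixes A :: "('m::{t2_space, second_countable_topology}, 'n::finite) chart set"
    and x \<nu> :: "'m \<Rightarrow> real \<Rightarrow> real ^ 'k::finite"
    and T :: real
    and V :: "('m \<times> real) set"
    and f :: "'m \<times> real \<Rightarrow> real"
    and a :: "'m \<times> real \<Rightarrow> real ^ 'k"
  assumes "smooth_atlas A"
    and "compact (UNIV :: 'm set)"
    and "CARD('k) = CARD('n) + 1"
    and "0 < T"
    and "vp_mcf A T x \<nu>"
    and "open V"
    and "V \<subseteq> UNIV \<times> {0<..<T}"
    and "C21_on A V f"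
    and "continuous_on (closure V) f"
    and "\<And>l t. (l, t) \<in> V \<Longrightarrow>
           deriv (\<lambda>s. f (l, s)) t - laplacian A (\<lambda>p. x p t) (\<lambda>p. f (p, t)) l
             \<le> a (l, t) \<bullet> gradient A (\<lambda>p. x p t) (\<lambda>p. f (p, t)) l"
    and "\<exists>N. open N \<and> {p \<in> V. \<forall>q\<in>V. f q \<le> f p} \<subseteq> N \<and> N \<subseteq> V \<and> continuous_on N a"
  shows "(SUP p\<in>V. ereal (f p)) \<le> (SUP p\<in>parabolic_boundary T V. ereal (f p)) \<and>
         ((SUP p\<in>V. ereal (f p)) > 0 \<longrightarrow>
           (SUP p\<in>V. ereal (f p)) \<le> (SUP p\<in>delta_boundary T V. ereal (f p)))"
proof -
  let ?\<delta> = "delta_boundary T V"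
  have penalised: "\<exists>d\<in>?\<delta>. f p - \<epsilon> * snd p \<le> f d - \<epsilon> * snd d" if "p \<in> V" "0 < \<epsilon>" for p \<epsilon>
  proof (rule exists_delta_boundary_ge[OF assms(2,7) _ _ \<open>p \<in> V\<close>])
    show "continuous_on (closure V) (\<lambda>q. f q - \<epsilon> * snd q)"
      by (intro continuous_intros assms(9))
    fix q assume "q \<in> V"
    obtain l t where q: "q = (l, t)" by (cases q)
    have "t \<in> {0<..<T}"
      using \<open>q \<in> V\<close> q assms(7) by auto
    then have "immersion A (\<lambda>p. x p t)"
      using assms(5) unfolding vp_mcf_def by blast
    moreover have lt: "(l, t) \<in> V"
      using \<open>q \<in> V\<close> q by simp
    ultimately have "\<exists>r\<in>V. snd r \<le> t \<and> f (l, t) - \<epsilon> * t < f r - \<epsilon> * snd r"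
      using no_time_penalised_max_in_domain[where X = x and a = "a (l, t)",
          OF assms(1,6,8) lt _ assms(10)[OF lt] \<open>0 < \<epsilon>\<close>]
      by blast
    then show "\<exists>r\<in>V. snd r \<le> snd q \<and> f q - \<epsilon> * snd q < f r - \<epsilon> * snd r"
      by (simp add: q)
  qed
  have "ereal (f p) \<le> (SUP d\<in>?\<delta>. ereal (f d))" if "p \<in> V" for p
  proof (rule ereal_le_epsilon2)
    fix e :: real assume "0 < e"
    (* With penalty e / T the loss over the whole time interval is at most e. *)
    have "0 < e / T"
      using \<open>0 < e\<close> \<open>0 < T\<close> by simp
    from penalised[OF \<open>p \<in> V\<close> this]
    obtain d where d: "d \<in> ?\<delta>" "f p - e / T * snd p \<le> f d - e / T * snd d"
      by blast
    have "closure V \<subseteq> UNIV \<times> {0..T}"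
      by (rule closure_minimal) (use assms(7) in \<open>auto intro!: closed_Times\<close>)
    moreover have "d \<in> closure V"
      using d(1) by (simp add: delta_boundary_def parabolic_boundary_def bdry_def)
    ultimately have "0 \<le> snd d"
      by auto
    then have "0 \<le> e / T * snd d"
      using \<open>0 < e\<close> \<open>0 < T\<close> by simp
    moreover have "snd p \<le> T"
      using \<open>p \<in> V\<close> assms(7) by auto
    then have "e / T * snd p \<le> e / T * T"
      using \<open>0 < e / T\<close> by (intro mult_left_mono) simp_all
    ultimately have "f p \<le> f d + e"
      using d(2) \<open>0 < T\<close> by simp
    then have "ereal (f p) \<le> ereal (f d) + ereal e"
      by simp
    also have "\<dots> \<le> (SUP d\<in>?\<delta>. ereal (f d)) + ereal e"
      using d(1) by (intro add_right_mono SUP_upper)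
    finally show "ereal (f p) \<le> (SUP d\<in>?\<delta>. ereal (f d)) + ereal e" .
  qed
  then have "(SUP p\<in>V. ereal (f p)) \<le> (SUP d\<in>?\<delta>. ereal (f d))"
    by (rule SUP_least)
  moreover have "(SUP d\<in>?\<delta>. ereal (f d)) \<le> (SUP d\<in>parabolic_boundary T V. ereal (f d))"
    by (rule SUP_subset_mono) (auto simp: delta_boundary_def)
  ultimately show ?thesis
    by (meson order_trans)
qed

end
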